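(* Let $\mathcal C\subseteq 2^{[n]}$ be an intersection complete code. Then $\operatorname{cdim}(\mathcal C)\le \operatorname{odim}(\mathcal C)$.
   Context: A code is a set $\mathcal C\subseteq 2^{[n]}$ of subsets of $[n]$ (codewords); by convention every code contains $\emptyset$. It is intersection complete if the intersection of any two codewords is a codeword. For $\mathcal U=\{U_1,\dots,U_n\}$ subsets of $\mathbb R^d$, $U_\sigma=\bigcap_{i\in\sigma}U_i$ ($U_\emptyset=\mathbb R^d$) and $\operatorname{code}(\mathcal U)=\{\sigma\subseteq[n] : U_\sigma\setminus\bigcup_{j\notin\sigma}U_j\neq\emptyset\}$. $\operatorname{odim}(\mathcal C)$ (resp. $\operatorname{cdim}(\mathcal C)$) is the least $d$ such that $\mathcal C=\operatorname{code}(\mathcal U)$ for some collection of (possibly empty) convex open (resp. convex closed) sets in $\mathbb R^d$, or $\infty$ if none exists. *)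

theory Defs
  imports "HOL-Analysis.Analysis" "HOL-Library.Extended_Nat"
begin

text \<open>
  The dimension has to range over the natural numbers inside the definitions of \<open>odim\<close> and
  \<open>cdim\<close>, so d-dimensional real space is the library topology \<open>Euclidean_space d\<close>, whose points
  are the functions \<open>nat \<Rightarrow> real\<close> vanishing at all indices \<open>\<ge> d\<close>.  The ground set [n] is
  \<open>{1..n}\<close>.
\<close>

definition is_code :: "nat \<Rightarrow> nat set set \<Rightarrow> bool" where
  "is_code n C \<longleftrightarrow> C \<subseteq> Pow {1..n} \<and> {} \<in> C"

definition intersection_complete :: "nat set set \<Rightarrow> bool" where
  "intersection_complete C \<longleftrightarrow> (\<forall>A\<in>C. \<forall>B\<in>C. A \<inter> B \<in> C)"

text \<open>
  The type \<open>nat \<Rightarrow> real\<close> is not an instance of \<open>real_vector\<close>; this is the definition of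
  \<open>convex\<close> with the vector operations written coordinatewise.
\<close>

definition convex_fun :: "(nat \<Rightarrow> real) set \<Rightarrow> bool" where
  "convex_fun S \<longleftrightarrow>
    (\<forall>x\<in>S. \<forall>y\<in>S. \<forall>u\<ge>0. \<forall>v\<ge>0. u + v = 1 \<longrightarrow> (\<lambda>i. u * x i + v * y i) \<in> S)"

text \<open>
  Intersecting with the whole space gives the empty index set the whole space as its intersection.
\<close>

definition cover_inter :: "nat \<Rightarrow> (nat \<Rightarrow> (nat \<Rightarrow> real) set) \<Rightarrow> nat set \<Rightarrow> (nat \<Rightarrow> real) set" where
  "cover_inter d U \<sigma> = topspace (Euclidean_space d) \<inter> (\<Inter>i\<in>\<sigma>. U i)"

definition code_of :: "nat \<Rightarrow> nat \<Rightarrow> (nat \<Rightarrow> (nat \<Rightarrow> real) set) \<Rightarrow> nat set set" where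
  "code_of n d U = {\<sigma>. \<sigma> \<subseteq> {1..n} \<and> cover_inter d U \<sigma> - (\<Union>j\<in>{1..n} - \<sigma>. U j) \<noteq> {}}"

definition open_convex_realizable :: "nat \<Rightarrow> nat set set \<Rightarrow> nat \<Rightarrow> bool" where
  "open_convex_realizable n C d \<longleftrightarrow>
    (\<exists>U. (\<forall>i\<in>{1..n}. openin (Euclidean_space d) (U i) \<and> convex_fun (U i)) \<and> C = code_of n d U)"

definition closed_convex_realizable :: "nat \<Rightarrow> nat set set \<Rightarrow> nat \<Rightarrow> bool" where
  "closed_convex_realizable n C d \<longleftrightarrow>
    (\<exists>U. (\<forall>i\<in>{1..n}. closedin (Euclidean_space d) (U i) \<and> convex_fun (U i)) \<and> C = code_of n d U)"

text \<open>In \<open>enat\<close> the infimum of the empty set is \<open>\<infinity>\<close>.\<close>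

definition odim :: "nat \<Rightarrow> nat set set \<Rightarrow> enat" where
  "odim n C = (INF d \<in> {d. open_convex_realizable n C d}. enat d)"

definition cdim :: "nat \<Rightarrow> nat set set \<Rightarrow> enat" where
  "cdim n C = (INF d \<in> {d. closed_convex_realizable n C d}. enat d)"

end

theory Submission
  imports Defs
begin

text \<open>
  Pick a point in every nonempty atom of an open realization \<open>U\<close> and replace each \<open>U i\<close> by its
  erosion, the set of centres of all \<open>\<epsilon>\<close>-boxes contained in \<open>U i\<close>.  Erosions of convex sets are
  convex, they are always closed, and for small \<open>\<epsilon>\<close> the chosen points survive, so no codeword is
  lost.  No codeword is gained either: if \<open>\<sigma> \<notin> C\<close>, intersection completeness yields
  \<open>j \<notin> \<sigma>\<close> lying in every codeword above \<open>\<sigma>\<close>, that is, \<open>\<Inter>i\<in>\<sigma>. U i\<close> is contained in \<open>U j\<close>, and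
  this inclusion is inherited by the erosions because erosion commutes with intersections.
\<close>

definition box_fun :: "nat \<Rightarrow> real \<Rightarrow> (nat \<Rightarrow> real) \<Rightarrow> (nat \<Rightarrow> real) set" where
  "box_fun d e x = {y \<in> topspace (Euclidean_space d). \<forall>i<d. \<bar>y i - x i\<bar> < e}"

definition erosion :: "nat \<Rightarrow> real \<Rightarrow> (nat \<Rightarrow> real) set \<Rightarrow> (nat \<Rightarrow> real) set" where
  "erosion d e S = {x \<in> topspace (Euclidean_space d). box_fun d e x \<subseteq> S}"

lemma centre_in_box_fun:
  "x \<in> topspace (Euclidean_space d) \<Longrightarrow> e > 0 \<Longrightarrow> x \<in> box_fun d e x"
  by (simp add: box_fun_def)

lemma box_fun_mono: "e \<le> e' \<Longrightarrow> box_fun d e x \<subseteq> box_fun d e' x"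
  by (force simp: box_fun_def)

lemma erosion_subset: "e > 0 \<Longrightarrow> erosion d e S \<subseteq> S"
  using centre_in_box_fun by (fastforce simp: erosion_def)

lemma openin_box_fun: "openin (Euclidean_space d) (box_fun d e x)"
proof -
  have "openin (Euclidean_space d) (topspace (Euclidean_space d) \<inter>
      (\<Inter>i\<in>{..<d}. {y \<in> topspace (Euclidean_space d). y i \<in> {x i - e <..< x i + e}}))"
  \<comment> \<open>For \<open>d = 0\<close> the intersection over the empty index set leaves the
    whole space; otherwise the box is a finite nonempty intersection of preimages of open intervals
    under coordinate projections.\<close>
  proof (cases "d = 0")
    case False
    have "continuous_map (Euclidean_space d) euclideanreal (\<lambda>y. y i)" for i
      unfolding Euclidean_space_def
      by (intro continuous_map_from_subtopology continuous_map_product_projection) auto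
    then show ?thesis
      using False
      by (intro openin_Int openin_topspace openin_INT2 openin_continuous_map_preimage) auto
  qed simp
  also have "(topspace (Euclidean_space d) \<inter>
      (\<Inter>i\<in>{..<d}. {y \<in> topspace (Euclidean_space d). y i \<in> {x i - e <..< x i + e}}))
      = box_fun d e x"
    by (force simp: box_fun_def abs_less_iff)
  finally show ?thesis .
qed

text \<open>Lying in each other's box is a symmetric relation, so a point fails to be in the erosion
  exactly when it lies in the open box around some point outside \<open>S\<close>. Hence the
  complement is open, whatever \<open>S\<close> is.\<close>

lemma closedin_erosion: "closedin (Euclidean_space d) (erosion d e S)"
  unfolding closedin_def
proof
  have "topspace (Euclidean_space d) - erosion d e S
      = (\<Union>y \<in> topspace (Euclidean_space d) - S. box_fun d e y)"
    by (auto simp: erosion_def box_fun_def abs_minus_commute)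
  then show "openin (Euclidean_space d) (topspace (Euclidean_space d) - erosion d e S)"
    by (auto intro: openin_box_fun)
qed (auto simp: erosion_def)

lemma convex_fun_erosion:
  assumes "convex_fun S"
  shows "convex_fun (erosion d e S)"
  unfolding convex_fun_def
proof (intro ballI allI impI)
  fix x y u v
  assume x: "x \<in> erosion d e S" and y: "y \<in> erosion d e S"
    and uv: "(0::real) \<le> u" "(0::real) \<le> v" "u + v = 1"
  let ?z = "\<lambda>i. u * x i + v * y i"
  have "w \<in> S" if w: "w \<in> box_fun d e ?z" for w
  proof -
    \<comment> \<open>Shift \<open>x\<close> and \<open>y\<close> by the offset of \<open>w\<close>
      from \<open>?z\<close>. Both shifted points stay in their boxes, and since
      \<open>u + v = 1\<close> their convex combination is \<open>w\<close>.\<close>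
    let ?a = "\<lambda>i. x i + (w i - ?z i)" and ?b = "\<lambda>i. y i + (w i - ?z i)"
    have "?a \<in> box_fun d e x" "?b \<in> box_fun d e y"
      using x y w by (auto simp: erosion_def box_fun_def topspace_Euclidean_space)
    then have "?a \<in> S" "?b \<in> S"
      using x y by (auto simp: erosion_def)
    then have "(\<lambda>i. u * ?a i + v * ?b i) \<in> S"
      using assms uv by (auto simp: convex_fun_def)
    moreover have "u * ?a i + v * ?b i = w i" for i
    proof -
      have "u * ?a i + v * ?b i = ?z i + (u + v) * (w i - ?z i)"
        by (simp only: algebra_simps)
      then show ?thesis using uv by simp
    qed
    ultimately show ?thesis by simp
  qed
  then show "?z \<in> erosion d e S"
    using x y by (auto simp: erosion_def topspace_Euclidean_space)
qed

lemma finite_positive_lower_bound: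
  fixes A :: "real set"
  assumes "finite A" "\<forall>r\<in>A. r > 0"
  shows "\<exists>e>0. \<forall>r\<in>A. e \<le> r"
  \<comment> \<open>Inserting 1 keeps the minimum meaningful when \<open>A\<close> is empty.\<close>
  using assms by (intro exI[of _ "Min (insert 1 A)"]) auto

text \<open>A basic product neighbourhood gives each coordinate its own radius. Only the first
  \<open>d\<close> radii constrain points of the space, so a common positive lower bound exists;
  beyond them all coordinates are 0.\<close>

lemma openin_Euclidean_space_contains_box_fun:
  assumes "openin (Euclidean_space d) S" "p \<in> S"
  obtains e where "e > 0" "box_fun d e p \<subseteq> S"
proof -
  obtain T where T: "openin (powertop_real UNIV) T" "S = T \<inter> topspace (Euclidean_space d)"
    using assms(1) by (auto simp: Euclidean_space_def openin_subtopology topspace_subtopology)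
  obtain X where X: "p \<in> PiE UNIV X" "\<And>i. open (X i)" "PiE UNIV X \<subseteq> T"
    using product_topology_open_contains_basis[OF T(1), of p] assms(2) T(2) by auto
  have "\<exists>e>0. \<forall>t. \<bar>t - p i\<bar> < e \<longrightarrow> t \<in> X i" for i
    using X(1) X(2)[of i] by (auto simp: open_dist dist_real_def)
  then obtain f where f: "\<And>i. f i > 0" "\<And>i t. \<bar>t - p i\<bar> < f i \<Longrightarrow> t \<in> X i"
    by metis
  have "\<exists>e>0. \<forall>r \<in> f ` {..<d}. e \<le> r"
    using f(1) by (intro finite_positive_lower_bound) auto
  then obtain e where "e > 0" and le: "\<And>i. i < d \<Longrightarrow> e \<le> f i"
    by auto
  moreover have "y \<in> S" if "y \<in> box_fun d e p" for y
  proof -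
    have "y i \<in> X i" for i
    proof (cases "i < d")
      case True
      then show ?thesis
        using that le[of i] by (intro f(2)) (auto simp: box_fun_def)
    next
      case False
      then have "y i = p i"
        using that assms(2) T(2) by (auto simp: box_fun_def topspace_Euclidean_space)
      then show ?thesis using X(1) by auto
    qed
    then show ?thesis
      using X(3) T(2) that by (auto simp: box_fun_def)
  qed
  ultimately show ?thesis using that by blast
qed

lemma intersection_complete_Inter:
  assumes "intersection_complete C" "finite W" "W \<noteq> {}" "W \<subseteq> C"
  shows "\<Inter>W \<in> C"
  using assms(2-4)
  by (induction W rule: finite_ne_induct)
    (use assms(1) in \<open>auto simp: intersection_complete_def\<close>)

lemma point_code_in_code_of:
  assumes "x \<in> topspace (Euclidean_space d)"
  shows "{i \<in> {1..n}. x \<in> U i} \<in> code_of n d U"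
  using assms by (auto simp: code_of_def cover_inter_def)

lemma code_of_erosion_subset:
  assumes ic: "intersection_complete (code_of n d U)" and e: "e > 0"
  shows "code_of n d (\<lambda>i. erosion d e (U i)) \<subseteq> code_of n d U"
proof
  fix \<sigma> assume "\<sigma> \<in> code_of n d (\<lambda>i. erosion d e (U i))"
  then obtain x where \<sigma>: "\<sigma> \<subseteq> {1..n}" and xt: "x \<in> topspace (Euclidean_space d)"
    and xin: "\<And>i. i \<in> \<sigma> \<Longrightarrow> x \<in> erosion d e (U i)"
    and xout: "\<And>i. i \<in> {1..n} - \<sigma> \<Longrightarrow> x \<notin> erosion d e (U i)"
    unfolding code_of_def cover_inter_def by blast
  \<comment> \<open>By intersection completeness \<open>\<Inter>W\<close> is the smallest codeword
    above \<open>\<sigma>\<close>; the aim is to show that it equals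
    \<open>\<sigma>\<close>.\<close>
  define W where "W = {c \<in> code_of n d U. \<sigma> \<subseteq> c}"
  have "{i \<in> {1..n}. x \<in> U i} \<in> W"
    using point_code_in_code_of[OF xt] \<sigma> xin erosion_subset[OF e] by (fastforce simp: W_def)
  moreover have "finite W"
    by (rule finite_subset[of _ "Pow {1..n}"]) (auto simp: W_def code_of_def)
  ultimately have W: "\<Inter>W \<in> code_of n d U" "W \<noteq> {}"
    using intersection_complete_Inter[OF ic] by (auto simp: W_def)
  have "\<Inter>W \<subseteq> \<sigma>"
  proof (rule ccontr)
    assume "\<not> \<Inter>W \<subseteq> \<sigma>"
    then obtain j where j: "j \<in> \<Inter>W" "j \<notin> \<sigma>" by blast
    \<comment> \<open>Each point of the box lies in \<open>U i\<close> for all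
      \<open>i \<in> \<sigma>\<close>, so its codeword belongs to \<open>W\<close> and contains
      \<open>j\<close>. The whole box is then inside \<open>U j\<close>, which puts \<open>x\<close>
      in an erosion that it was chosen to avoid.\<close>
    have "y \<in> U j" if "y \<in> box_fun d e x" for y
    proof -
      have "{i \<in> {1..n}. y \<in> U i} \<in> W"
        using point_code_in_code_of[of y d n U] \<sigma> xin that
        by (auto simp: W_def erosion_def box_fun_def)
      then show ?thesis using j by blast
    qed
    then have "x \<in> erosion d e (U j)"
      using xt by (auto simp: erosion_def)
    moreover have "j \<in> {1..n}"
      using W(1) j(1) by (auto simp: code_of_def)
    ultimately show False using xout j(2) by blast
  qed
  moreover have "\<sigma> \<subseteq> \<Inter>W" by (auto simp: W_def)
  ultimately show "\<sigma> \<in> code_of n d U" using W(1) by simp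
qed

text \<open>One witness per codeword gives finitely many membership conditions, each with its own
  radius by openness, so one \<open>e\<close> serves all. Non-memberships persist because erosion
  only shrinks sets.\<close>

lemma code_of_subset_erosion:
  assumes op: "\<And>i. i \<in> {1..n} \<Longrightarrow> openin (Euclidean_space d) (U i)"
  obtains e where "e > 0" "code_of n d U \<subseteq> code_of n d (\<lambda>i. erosion d e (U i))"
proof -
  let ?C = "code_of n d U"
  have "\<forall>c\<in>?C. \<exists>x. x \<in> cover_inter d U c - (\<Union>j\<in>{1..n} - c. U j)"
    by (auto simp: code_of_def)
  from bchoice[OF this] obtain p
    where p: "\<And>c. c \<in> ?C \<Longrightarrow> p c \<in> cover_inter d U c - (\<Union>j\<in>{1..n} - c. U j)"
    by blast
  \<comment> \<open>The pairs \<open>(c, i)\<close> with \<open>i \<in> c\<close> index the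
    conditions that \<open>p c\<close> remains in the erosion of \<open>U i\<close>.\<close>
  let ?I = "SIGMA c:?C. c"
  have "finite ?C"
    by (rule finite_subset[of _ "Pow {1..n}"]) (auto simp: code_of_def)
  moreover have sub: "c \<subseteq> {1..n}" if "c \<in> ?C" for c
    using that by (auto simp: code_of_def)
  ultimately have fin: "finite ?I"
    by (intro finite_SigmaI) (auto intro: finite_subset)
  have "\<exists>e>0. box_fun d e (p (fst k)) \<subseteq> U (snd k)" if "k \<in> ?I" for k
  proof -
    have c: "fst k \<in> ?C" and i: "snd k \<in> fst k"
      using that by auto
    have "p (fst k) \<in> U (snd k)"
      using p[OF c] i by (auto simp: cover_inter_def)
    moreover have "snd k \<in> {1..n}"
      using sub[OF c] i by (rule subsetD)
    ultimately show ?thesis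
      using openin_Euclidean_space_contains_box_fun[OF op] by blast
  qed
  then have "\<forall>k\<in>?I. \<exists>e. e > 0 \<and> box_fun d e (p (fst k)) \<subseteq> U (snd k)"
    by blast
  then obtain f where f: "\<forall>k\<in>?I. f k > 0 \<and> box_fun d (f k) (p (fst k)) \<subseteq> U (snd k)"
    by (rule bchoice[THEN exE])
  have "\<exists>e>0. \<forall>r \<in> f ` ?I. e \<le> r"
  proof (rule finite_positive_lower_bound)
    show "finite (f ` ?I)" using fin by (rule finite_imageI)
    show "\<forall>r \<in> f ` ?I. r > 0"
      unfolding ball_simps using f[THEN bspec, THEN conjunct1] by (rule ballI)
  qed
  then obtain e where e: "e > 0" and le: "\<forall>r \<in> f ` ?I. e \<le> r"
    by (elim exE conjE)
  have er: "p c \<in> erosion d e (U i)" if c: "c \<in> ?C" and i: "i \<in> c" for c i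
  proof -
    have k: "(c, i) \<in> ?I" using that by blast
    have "e \<le> f (c, i)"
      using le imageI[OF k] by (rule bspec)
    then have "box_fun d e (p c) \<subseteq> box_fun d (f (c, i)) (p c)"
      by (rule box_fun_mono)
    also have "\<dots> \<subseteq> U i"
      using f[THEN bspec, OF k] by simp
    finally show ?thesis
      using p[OF c] by (simp add: erosion_def cover_inter_def)
  qed
  have "c \<in> code_of n d (\<lambda>i. erosion d e (U i))" if c: "c \<in> ?C" for c
  proof -
    have "p c \<in> cover_inter d (\<lambda>i. erosion d e (U i)) c"
      using p[OF c] er[OF c] by (simp add: cover_inter_def)
    moreover have "p c \<notin> (\<Union>j\<in>{1..n} - c. erosion d e (U j))"
      using p[OF c] erosion_subset[OF e] by blast
    ultimately show ?thesis
      using sub[OF c] unfolding code_of_def by blast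
  qed
  then show ?thesis
    using that[OF e] by (simp add: subsetI)
qed

lemma closed_convex_realizable_if_open:
  assumes "intersection_complete C" "open_convex_realizable n C d"
  shows "closed_convex_realizable n C d"
proof -
  obtain U where U: "\<And>i. i \<in> {1..n} \<Longrightarrow> openin (Euclidean_space d) (U i)"
      "\<And>i. i \<in> {1..n} \<Longrightarrow> convex_fun (U i)" and C: "C = code_of n d U"
    using assms(2) unfolding open_convex_realizable_def by blast
  obtain e where e: "e > 0" "code_of n d U \<subseteq> code_of n d (\<lambda>i. erosion d e (U i))"
    by (rule code_of_subset_erosion[of n d U]) (use U(1) in simp)
  have "C = code_of n d (\<lambda>i. erosion d e (U i))"
    using e(2) code_of_erosion_subset[OF assms(1)[unfolded C] e(1)] C by (intro equalityI) auto
  then show ?thesis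
    unfolding closed_convex_realizable_def
    using U(2) by (intro exI[of _ "\<lambda>i. erosion d e (U i)"])
      (simp add: closedin_erosion convex_fun_erosion)
qed

theorem theorem1p6:
  fixes n :: nat and C :: "nat set set"
  assumes "is_code n C"
    and "intersection_complete C"
  shows "cdim n C \<le> odim n C"
  unfolding cdim_def odim_def
  \<comment> \<open>The dimension is preserved, so the infimum for \<open>cdim\<close> ranges over a
    larger set; this includes the case where \<open>odim\<close> is
    \<open>\<infinity>\<close>.\<close>
  using closed_convex_realizable_if_open[OF assms(2)] by (intro INF_superset_mono) auto

end
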